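(* Let $g$ be a Gårding polynomial of degree $N\ge1$ on a finite-dimensional real vector space $V$ with Gårding cone $\Gamma$, let $\Gamma^*$ be the open polar and $g^*:\Gamma^*\to\mathbb{R}$ the dual Gårding function. The dual potential $f^*(y)=\log g^*(y)$ of the potential function $f(x)=\log g(x)$ is given by $$f^*(y)=\inf_{x\in\Gamma}\bigl(\langle y,x\rangle-f(x)-N\bigr)\qquad\text{for all }y\in\Gamma^*.$$
   Context: A Gårding polynomial of degree $N$ on a finite-dimensional real vector space $V$ is a homogeneous real polynomial $g$ of degree $N$ on $V$ together with a connected component $\Gamma$ of $\{g>0\}$ (the Gårding cone) such that for some $e\in\Gamma$ and every $v\in V$ the polynomial $t\mapsto g(te+v)$ has exactly $N$ real roots counted with multiplicity. The cone $\Gamma$ is then open and convex. Its edge is the linear subspace $E=\overline\Gamma\cap(-\overline\Gamma)$, and $g(x+v)=g(x)$ for all $x\in V$, $v\in E$. The polar is $\Gamma^0=\{y\in V^*:\langle y,x\rangle\ge0\ \forall x\in\Gamma\}$; the open polar $\Gamma^*$ is the interior of $\Gamma^0$ relative to its linear span $S\subset V^*$ (the annihilator of $E$). For $x\in\Gamma$ put $F(x)=D_x\log g\in V^*$. This depends only on the class of $x$ in $\Gamma/E$, and $F$ induces a bijection $\Gamma/E\to\Gamma^*$. The dual Gårding function is $g^*(y)=1/g(x)$ for $y\in\Gamma^*$, where $x\in\Gamma$ is any point with $F(x)=y$. *)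

theory Defs
  imports "HOL-Analysis.Analysis" "HOL-Computational_Algebra.Polynomial"
begin

definition homogeneous_polynomial :: "nat \<Rightarrow> ('a::euclidean_space \<Rightarrow> real) \<Rightarrow> bool" where
  "homogeneous_polynomial N g \<longleftrightarrow>
     real_polynomial_function g \<and> (\<forall>c x. g (c *\<^sub>R x) = c ^ N * g x)"

(* The polynomial p representing t |-> g (t e + v) is unique; proots is the multiset of its
   real roots, so its size counts them with multiplicity. *)
definition garding_polynomial ::
    "nat \<Rightarrow> ('a::euclidean_space \<Rightarrow> real) \<Rightarrow> 'a set \<Rightarrow> bool" where
  "garding_polynomial N g \<Gamma> \<longleftrightarrow>
     homogeneous_polynomial N g \<and>
     \<Gamma> \<in> components {x. g x > 0} \<and>
     (\<exists>e\<in>\<Gamma>. \<forall>v. \<exists>p :: real poly.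
        (\<forall>t. poly p t = g (t *\<^sub>R e + v)) \<and> p \<noteq> 0 \<and> size (proots p) = N)"

(* The dual space is the space of bounded linear functionals, which on a Euclidean space
   are all linear functionals. *)
definition polar :: "'a::euclidean_space set \<Rightarrow> ('a \<Rightarrow>\<^sub>L real) set" where
  "polar \<Gamma> = {y. \<forall>x\<in>\<Gamma>. blinfun_apply y x \<ge> 0}"

definition open_polar :: "'a::euclidean_space set \<Rightarrow> ('a \<Rightarrow>\<^sub>L real) set" where
  "open_polar \<Gamma> = (top_of_set (span (polar \<Gamma>))) interior_of (polar \<Gamma>)"

definition potential :: "('a::euclidean_space \<Rightarrow> real) \<Rightarrow> 'a \<Rightarrow> real" where
  "potential g x = ln (g x)"

definition garding_gradient :: "('a::euclidean_space \<Rightarrow> real) \<Rightarrow> 'a \<Rightarrow> ('a \<Rightarrow>\<^sub>L real)" where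
  "garding_gradient g x = Blinfun (frechet_derivative (\<lambda>z. ln (g z)) (at x))"

(* Meaningful for y in the open polar, where 1 / g x is the same for all x in \<Gamma> with
   garding_gradient g x = y and such x exist. *)
definition dual_garding_function ::
    "('a::euclidean_space \<Rightarrow> real) \<Rightarrow> 'a set \<Rightarrow> ('a \<Rightarrow>\<^sub>L real) \<Rightarrow> real" where
  "dual_garding_function g \<Gamma> y =
     (THE c. \<exists>x\<in>\<Gamma>. garding_gradient g x = y \<and> c = 1 / g x)"

definition dual_potential ::
    "('a::euclidean_space \<Rightarrow> real) \<Rightarrow> 'a set \<Rightarrow> ('a \<Rightarrow>\<^sub>L real) \<Rightarrow> real" where
  "dual_potential g \<Gamma> y = ln (dual_garding_function g \<Gamma> y)"

end

theory Submission
  imports Defs "HOL-Computational_Algebra.Fundamental_Theorem_Algebra"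
begin

text \<open>
The dual potential is a Legendre transform. On the Garding cone \<open>\<Gamma>\<close> the function \<open>ln g\<close> is
concave, so \<open>y - ln g\<close> is convex for a linear functional \<open>y\<close>, and its minimizers are exactly the
points \<open>x\<close> with \<open>D\<^sub>x ln g = y\<close>. At such a point Euler's identity gives \<open>y x = N\<close>, so the minimum
of \<open>y - ln g - N\<close> is \<open>- ln (g x)\<close>, which is the logarithm of \<open>1 / g x\<close>. This also shows that
\<open>g x\<close> depends on \<open>y\<close> alone, that is, that the dual Garding function is well defined. Two facts carry
the argument: concavity (\<open>garding_concave_ln\<close>), and existence of a minimizer for every \<open>y\<close> in the
open polar (\<open>garding_minimizer\<close>).

Concavity is Garding's theorem. The polynomial is assumed to be hyperbolic in one direction of the
cone only, and the main step (\<open>hyperbolic_direction_if_segment_positive\<close>) extends this to every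
direction in it, by following the zeros of a complexification of \<open>g\<close>. Since the cone is star-shaped
about each of its hyperbolic directions (\<open>positive_component_eq_segments\<close>), it is convex. On a line
through a point of the cone \<open>g\<close> is a product of real affine factors, so \<open>ln g\<close> is a sum of concave
functions there.

For existence, \<open>y\<close> and \<open>g\<close> are both invariant under the edge of the cone. On a complement of the
edge, \<open>y\<close> in the relative interior of the polar is strictly positive on the closed cone minus the
origin, hence the slice \<open>{y = N}\<close> is compact there (\<open>compact_slice\<close>). The maximum of \<open>g\<close> on this
slice is the desired minimizer: homogeneity of \<open>g\<close> and \<open>ln s \<le> s - 1\<close> take care of the other
slices.
\<close>

section \<open>Polynomials on the real and on the complex line\<close>

lemma at_infinity_not_bot: "at_infinity \<noteq> (bot :: 'a::real_normed_algebra_1 filter)"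
proof
  assume "at_infinity = (bot :: 'a filter)"
  then obtain b where "\<And>x::'a. \<not> b \<le> norm x"
    using eventually_at_infinity[of "\<lambda>x::'a. False"] by auto
  from this[of "of_real b"] show False by simp
qed

lemma degree_lead_coeff_eqI:
  fixes p :: "'a::real_normed_field poly"
  assumes lim: "((\<lambda>x. poly p x / x ^ N) \<longlongrightarrow> c) at_infinity" and c: "c \<noteq> 0"
  shows "degree p = N" "lead_coeff p = c"
proof -
  have inv: "((\<lambda>x::'a. inverse x ^ k) \<longlongrightarrow> 0) at_infinity" if "k > 0" for k
    using tendsto_power[OF tendsto_inverse_0, of k] that by (simp add: zero_power)
  have nz: "\<forall>\<^sub>F x::'a in at_infinity. x \<noteq> 0"
    by (rule eventually_not_equal_at_infinity)
  have d: "((\<lambda>x. poly p x / x ^ degree p) \<longlongrightarrow> lead_coeff p) at_infinity"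
    by (rule poly_divide_tendsto_aux)
  have nbot: "at_infinity \<noteq> (bot::'a filter)"
    by (rule at_infinity_not_bot)
  have p: "lead_coeff p \<noteq> 0"
    using lim c tendsto_unique[OF nbot, of _ c 0] by (cases "p = 0") auto
  show deg: "degree p = N"
  proof (rule linorder_cases[of "degree p" N])
    assume less: "degree p < N"
    have "((\<lambda>x. poly p x / x ^ degree p * inverse x ^ (N - degree p)) \<longlongrightarrow> lead_coeff p * 0) at_infinity"
      by (rule tendsto_mult[OF d inv]) (use less in simp)
    moreover have "\<forall>\<^sub>F x in at_infinity. poly p x / x ^ degree p * inverse x ^ (N - degree p) = poly p x / x ^ N"
      using nz
    proof eventually_elim
      case (elim x)
      have "x ^ N = x ^ degree p * x ^ (N - degree p)"
        using less by (simp flip: power_add)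
      with elim show ?case by (simp add: divide_simps)
    qed
    ultimately have "((\<lambda>x. poly p x / x ^ N) \<longlongrightarrow> 0) at_infinity"
      by (simp add: filterlim_cong)
    with lim c nbot show ?thesis using tendsto_unique by blast
  next
    assume less: "N < degree p"
    have "((\<lambda>x. poly p x / x ^ N * inverse x ^ (degree p - N)) \<longlongrightarrow> c * 0) at_infinity"
      by (rule tendsto_mult[OF lim inv]) (use less in simp)
    moreover have "\<forall>\<^sub>F x in at_infinity. poly p x / x ^ N * inverse x ^ (degree p - N) = poly p x / x ^ degree p"
      using nz
    proof eventually_elim
      case (elim x)
      have "x ^ degree p = x ^ N * x ^ (degree p - N)"
        using less by (simp flip: power_add)
      with elim show ?case by (simp add: divide_simps)
    qed
    ultimately have "((\<lambda>x. poly p x / x ^ degree p) \<longlongrightarrow> 0) at_infinity"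
      by (simp add: filterlim_cong)
    with d p nbot show ?thesis using tendsto_unique by blast
  qed
  show "lead_coeff p = c"
    using tendsto_unique[OF nbot d] lim deg by simp
qed

text \<open>If \<open>p(t) = t\<^sup>N h(1/t)\<close>, then \<open>h(0)\<close> is the coefficient of \<open>t\<^sup>N\<close>. This is how homogeneity
determines the degree and the leading coefficient of the restriction of a form of degree \<open>N\<close> to
a line: there \<open>h\<close> is the restriction to the same line seen from infinity.\<close>

lemma degree_lead_coeff_homogeneousI:
  fixes p :: "'a::real_normed_field poly"
  assumes eq: "\<And>t. t \<noteq> 0 \<Longrightarrow> poly p t = t ^ N * h (inverse t)"
    and h: "isCont h 0" "h 0 \<noteq> 0"
  shows "degree p = N" "lead_coeff p = h 0"
proof -
  have "((\<lambda>t. h (inverse t)) \<longlongrightarrow> h 0) at_infinity"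
    by (rule isCont_tendsto_compose[OF h(1) tendsto_inverse_0])
  moreover have "\<forall>\<^sub>F t in at_infinity. h (inverse t) = poly p t / t ^ N"
    using eventually_not_equal_at_infinity[of 0] by eventually_elim (simp add: eq)
  ultimately have "((\<lambda>t. poly p t / t ^ N) \<longlongrightarrow> h 0) at_infinity"
    by (simp add: filterlim_cong)
  from degree_lead_coeff_eqI[OF this h(2)] show "degree p = N" "lead_coeff p = h 0"
    by auto
qed

lemma poly_prod_mset_linear:
  "poly (\<Prod>r\<in>#A. [:f r, 1:]) t = (\<Prod>r\<in>#A. t + f r)"
  by (induction A) (auto simp: algebra_simps)

text \<open>The multiset \<open>A\<close> holds the negatives of the roots. With this sign convention the roots of
\<open>t \<mapsto> g(t a + v)\<close> become positive numbers when \<open>v\<close> lies in the cone of \<open>a\<close>.\<close>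

lemma linear_factorization_if_size_proots:
  fixes p :: "'a::field poly"
  assumes "p \<noteq> 0" "size (proots p) = degree p"
  shows "\<exists>A. size A = degree p \<and> p = smult (lead_coeff p) (\<Prod>r\<in>#A. [:r, 1:])"
  using assms
proof (induction "degree p" arbitrary: p)
  case 0
  then obtain c where "p = [:c:]" by (metis degree_eq_zeroE)
  then show ?case by (intro exI[of _ "{#}"]) simp
next
  case (Suc n)
  then obtain x where "x \<in># proots p"
    by (metis size_eq_Suc_imp_elem)
  with Suc.prems have "poly p x = 0" by simp
  then obtain q where q: "p = [:-x, 1:] * q"
    by (metis poly_eq_0_iff_dvd dvdE)
  with Suc.prems have "q \<noteq> 0" by auto
  with q have deg: "degree p = Suc (degree q)"
    by (simp add: degree_mult_eq del: mult_pCons_left)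
  moreover have "proots p = {#x#} + proots q"
    unfolding q using \<open>q \<noteq> 0\<close> by (subst proots_mult) auto
  ultimately have "size (proots q) = degree q"
    using Suc.prems by simp
  with Suc.hyps \<open>q \<noteq> 0\<close> deg obtain A
    where A: "size A = degree q" "q = smult (lead_coeff q) (\<Prod>r\<in>#A. [:r, 1:])"
    by auto
  have "lead_coeff p = lead_coeff q"
    unfolding q by (subst lead_coeff_mult) simp
  then have "p = smult (lead_coeff p) (\<Prod>r\<in>#add_mset (-x) A. [:r, 1:])"
    using q A(2) by (metis image_mset_add_mset mult_smult_right prod_mset.add_mset)
  with A(1) deg show ?case
    by (intro exI[of _ "add_mset (-x) A"]) simp
qed

lemma poly_eq_if_eq_on_reals:
  fixes p q :: "complex poly"
  assumes "\<And>t::real. poly p (of_real t) = poly q (of_real t)"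
  shows "p = q"
proof (rule ccontr)
  assume "p \<noteq> q"
  then have "finite {z. poly (p - q) z = 0}"
    by (intro poly_roots_finite) simp
  moreover have "range complex_of_real \<subseteq> {z. poly (p - q) z = 0}"
    using assms by auto
  ultimately have "finite (range complex_of_real)"
    using finite_subset by blast
  then show False
    using finite_imageD[OF _ inj_of_real] infinite_UNIV_char_0 by blast
qed

section \<open>Complex polynomials in three variables\<close>

text \<open>Polynomials in several variables enter the argument through two properties: continuity, and the
fact that the restriction to every complex line is a polynomial in one variable. Both are
inherited by sums and products.\<close>

definition complex_polynomial3 :: "(complex \<Rightarrow> complex \<Rightarrow> complex \<Rightarrow> complex) \<Rightarrow> bool" where
  "complex_polynomial3 G \<longleftrightarrow>
     continuous_on UNIV (\<lambda>(x, y, z). G x y z) \<and>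
     (\<forall>x y z x' y' z'. \<exists>p. \<forall>t. G (x + t * x') (y + t * y') (z + t * z') = poly p t)"

lemma complex_polynomial3_lineE:
  assumes "complex_polynomial3 G"
  obtains p where "\<And>t. G (x + t * x') (y + t * y') (z + t * z') = poly p t"
  using assms unfolding complex_polynomial3_def by blast

lemma complex_polynomial3_continuous:
  assumes "complex_polynomial3 G" "continuous_on S f" "continuous_on S g" "continuous_on S h"
  shows "continuous_on S (\<lambda>w. G (f w) (g w) (h w))"
proof -
  have "continuous_on UNIV (\<lambda>(x, y, z). G x y z)"
    using assms(1) by (simp add: complex_polynomial3_def)
  from continuous_on_compose2[OF this, of S "\<lambda>w. (f w, g w, h w)"] assms(2-)
  show ?thesis by (simp add: continuous_on_Pair)
qed

lemma complex_polynomial3_linear: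
  "complex_polynomial3 (\<lambda>x y z. a * x + b * y + c * z + d)"
  unfolding complex_polynomial3_def
proof (intro conjI allI)
  show "continuous_on UNIV (\<lambda>(x, y, z). a * x + b * y + c * z + d)"
    by (auto simp: case_prod_beta intro!: continuous_intros)
  fix x y z x' y' z'
  show "\<exists>p. \<forall>t. a * (x + t * x') + b * (y + t * y') + c * (z + t * z') + d = poly p t"
    by (rule exI[of _ "[:a * x + b * y + c * z + d, a * x' + b * y' + c * z':]"])
      (simp add: algebra_simps)
qed

lemma complex_polynomial3_add:
  assumes "complex_polynomial3 F" "complex_polynomial3 G"
  shows "complex_polynomial3 (\<lambda>x y z. F x y z + G x y z)"
  unfolding complex_polynomial3_def
proof (intro conjI allI)
  show "continuous_on UNIV (\<lambda>(x, y, z). F x y z + G x y z)"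
    using assms by (auto simp: case_prod_beta complex_polynomial3_def intro!: continuous_intros)
  fix x y z x' y' z'
  obtain p where p: "\<And>t. F (x + t * x') (y + t * y') (z + t * z') = poly p t"
    using complex_polynomial3_lineE[OF assms(1)] by blast
  obtain q where q: "\<And>t. G (x + t * x') (y + t * y') (z + t * z') = poly q t"
    using complex_polynomial3_lineE[OF assms(2)] by blast
  show "\<exists>r. \<forall>t. F (x + t * x') (y + t * y') (z + t * z') +
      G (x + t * x') (y + t * y') (z + t * z') = poly r t"
    by (rule exI[of _ "p + q"]) (simp add: p q)
qed

lemma complex_polynomial3_mult:
  assumes "complex_polynomial3 F" "complex_polynomial3 G"
  shows "complex_polynomial3 (\<lambda>x y z. F x y z * G x y z)"
  unfolding complex_polynomial3_def
proof (intro conjI allI)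
  show "continuous_on UNIV (\<lambda>(x, y, z). F x y z * G x y z)"
    using assms by (auto simp: case_prod_beta complex_polynomial3_def intro!: continuous_intros)
  fix x y z x' y' z'
  obtain p where p: "\<And>t. F (x + t * x') (y + t * y') (z + t * z') = poly p t"
    using complex_polynomial3_lineE[OF assms(1)] by blast
  obtain q where q: "\<And>t. G (x + t * x') (y + t * y') (z + t * z') = poly q t"
    using complex_polynomial3_lineE[OF assms(2)] by blast
  show "\<exists>r. \<forall>t. F (x + t * x') (y + t * y') (z + t * z') *
      G (x + t * x') (y + t * y') (z + t * z') = poly r t"
    by (rule exI[of _ "p * q"]) (simp add: p q)
qed

lemma complex_polynomial3_scale:
  assumes "complex_polynomial3 G"
  shows "complex_polynomial3 (\<lambda>x y z. G (c * x) (c * y) (c * z))"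
  unfolding complex_polynomial3_def
proof (intro conjI allI)
  show "continuous_on UNIV (\<lambda>(x, y, z). G (c * x) (c * y) (c * z))"
    unfolding case_prod_beta by (intro complex_polynomial3_continuous[OF assms] continuous_intros)
  fix x y z x' y' z'
  show "\<exists>p. \<forall>t. G (c * (x + t * x')) (c * (y + t * y')) (c * (z + t * z')) = poly p t"
    by (rule complex_polynomial3_lineE[OF assms, of "c * x" "c * x'" "c * y" "c * y'" "c * z" "c * z'"])
      (auto simp: algebra_simps)
qed

text \<open>Every point of \<open>\<complex>\<^sup>3\<close> is \<open>x + \<i> y\<close> with \<open>x\<close> and \<open>y\<close> real, hence lies on the complex line
\<open>t \<mapsto> x + t y\<close>. For real \<open>t\<close> this line consists of real points, and a polynomial in one
variable is determined by its values on the real axis.\<close>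

lemma complex_polynomial3_eq_if_eq_on_reals:
  assumes F: "complex_polynomial3 F" and G: "complex_polynomial3 G"
    and eq: "\<And>x y z :: real. F (of_real x) (of_real y) (of_real z) = G (of_real x) (of_real y) (of_real z)"
  shows "F x y z = G x y z"
proof -
  let ?l = "\<lambda>(w::complex) t. complex_of_real (Re w) + t * complex_of_real (Im w)"
  obtain p where p: "\<And>t. F (?l x t) (?l y t) (?l z t) = poly p t"
    using complex_polynomial3_lineE[OF F] by blast
  obtain q where q: "\<And>t. G (?l x t) (?l y t) (?l z t) = poly q t"
    using complex_polynomial3_lineE[OF G] by blast
  have "p = q"
  proof (rule poly_eq_if_eq_on_reals)
    fix t :: real
    show "poly p (of_real t) = poly q (of_real t)"
      using eq[of "Re x + t * Im x" "Re y + t * Im y" "Re z + t * Im z"]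
      by (simp flip: p q)
  qed
  moreover have "?l w \<i> = w" for w
    by (simp add: complex_eq_iff)
  ultimately show ?thesis
    using p[of \<i>] q[of \<i>] by metis
qed

lemma complex_polynomial3_homogeneous:
  assumes G: "complex_polynomial3 G"
    and hom: "\<And>c x y z :: real. G (of_real (c * x)) (of_real (c * y)) (of_real (c * z)) =
      of_real c ^ N * G (of_real x) (of_real y) (of_real z)"
  shows "G (c * x) (c * y) (c * z) = c ^ N * G x y z"
proof -
  have const: "complex_polynomial3 (\<lambda>x y z. d)" for d
    using complex_polynomial3_linear[of 0 0 0 d] by simp
  have real: "G (of_real c * x) (of_real c * y) (of_real c * z) = of_real c ^ N * G x y z" for c :: real
    by (rule complex_polynomial3_eq_if_eq_on_reals[OF complex_polynomial3_scale[OF G]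
          complex_polynomial3_mult[OF const G]])
      (use hom in simp)
  obtain p where p: "\<And>t. G (t * x) (t * y) (t * z) = poly p t"
    using complex_polynomial3_lineE[OF G, of 0 x 0 y 0 z] by auto
  have "p = monom (G x y z) N"
    by (rule poly_eq_if_eq_on_reals) (simp add: poly_monom real flip: p)
  then show ?thesis
    by (simp add: p poly_monom)
qed

text \<open>The restriction of \<open>g\<close> to the span of three vectors extends to complex coordinates. Three
coordinates suffice because hyperbolicity of \<open>g\<close> in a new direction \<open>a\<close> is a statement about \<open>a\<close>
and one further vector \<open>v\<close>, and its proof involves only one known hyperbolic direction \<open>e\<close>.\<close>

lemma complexification_exists:
  assumes "real_polynomial_function g"
  shows "\<exists>G. complex_polynomial3 G \<and> (\<forall>x y z. G (of_real x) (of_real y) (of_real z) =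
    of_real (g (x *\<^sub>R e + y *\<^sub>R a + z *\<^sub>R v)))"
  using assms
proof induction
  case (linear f)
  let ?G = "\<lambda>x y z. complex_of_real (f e) * x + of_real (f a) * y + of_real (f v) * z + 0"
  from linear have "linear f" by (rule bounded_linear.linear)
  then have "?G (of_real x) (of_real y) (of_real z) = of_real (f (x *\<^sub>R e + y *\<^sub>R a + z *\<^sub>R v))" for x y z
    by (simp add: linear_add linear_scale mult.commute)
  with complex_polynomial3_linear show ?case by blast
next
  case (const c)
  show ?case
    using complex_polynomial3_linear[of 0 0 0 "of_real c"] by force
next
  case (add f g)
  then obtain F G where "complex_polynomial3 F" "complex_polynomial3 G"
    "\<forall>x y z. F (of_real x) (of_real y) (of_real z) = of_real (f (x *\<^sub>R e + y *\<^sub>R a + z *\<^sub>R v))"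
    "\<forall>x y z. G (of_real x) (of_real y) (of_real z) = of_real (g (x *\<^sub>R e + y *\<^sub>R a + z *\<^sub>R v))"
    by blast
  then show ?case
    using complex_polynomial3_add[of F G]
    by (intro exI[of _ "\<lambda>x y z. F x y z + G x y z"]) simp
next
  case (mult f g)
  then obtain F G where "complex_polynomial3 F" "complex_polynomial3 G"
    "\<forall>x y z. F (of_real x) (of_real y) (of_real z) = of_real (f (x *\<^sub>R e + y *\<^sub>R a + z *\<^sub>R v))"
    "\<forall>x y z. G (of_real x) (of_real y) (of_real z) = of_real (g (x *\<^sub>R e + y *\<^sub>R a + z *\<^sub>R v))"
    by blast
  then show ?case
    using complex_polynomial3_mult[of F G]
    by (intro exI[of _ "\<lambda>x y z. F x y z * G x y z"]) simp
qed

section \<open>Hyperbolic directions\<close>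

text \<open>The numbers in \<open>A\<close> are the negatives of the roots of \<open>t \<mapsto> g(t a + v)\<close>.\<close>

definition hyperbolic_direction :: "nat \<Rightarrow> ('a::real_vector \<Rightarrow> real) \<Rightarrow> 'a \<Rightarrow> bool" where
  "hyperbolic_direction N g a \<longleftrightarrow>
     (\<forall>v. \<exists>A. size A = N \<and> (\<forall>t. g (t *\<^sub>R a + v) = g a * (\<Prod>r\<in>#A. t + r)))"

lemma hyperbolic_directionE:
  assumes "hyperbolic_direction N g a"
  obtains A where "size A = N" "\<And>t. g (t *\<^sub>R a + v) = g a * (\<Prod>r\<in>#A. t + r)"
  using assms unfolding hyperbolic_direction_def by blast

lemma hyperbolic_directionI_proots:
  fixes g :: "'a::real_normed_vector \<Rightarrow> real"
  assumes cont: "continuous_on UNIV g" and hom: "\<And>c x. g (c *\<^sub>R x) = c ^ N * g x"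
    and e: "g e \<noteq> 0"
    and roots: "\<And>v. \<exists>p. (\<forall>t. poly p t = g (t *\<^sub>R e + v)) \<and> p \<noteq> 0 \<and> size (proots p) = N"
  shows "hyperbolic_direction N g e"
  unfolding hyperbolic_direction_def
proof
  fix v
  obtain p where p: "\<And>t. poly p t = g (t *\<^sub>R e + v)" "p \<noteq> 0" "size (proots p) = N"
    using roots by blast
  let ?h = "\<lambda>u. g (e + u *\<^sub>R v)"
  have eq: "poly p t = t ^ N * ?h (inverse t)" if "t \<noteq> 0" for t
    using that hom[of t "e + inverse t *\<^sub>R v"] by (simp add: p(1) scaleR_add_right)
  have "continuous_on UNIV ?h"
    by (rule continuous_on_compose2[OF cont]) (auto intro!: continuous_intros)
  then have "isCont ?h 0"
    by (simp add: continuous_on_eq_continuous_at)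
  from degree_lead_coeff_homogeneousI[OF eq this] e
  have "degree p = N" "lead_coeff p = g e" by auto
  with linear_factorization_if_size_proots[OF p(2)] p(3) obtain A
    where "size A = N" "p = smult (g e) (\<Prod>r\<in>#A. [:r, 1:])" by auto
  then show "\<exists>A. size A = N \<and> (\<forall>t. g (t *\<^sub>R e + v) = g e * (\<Prod>r\<in>#A. t + r))"
    by (intro exI[of _ A]) (simp add: poly_prod_mset_linear flip: p(1))
qed

lemma prod_mset_one_plus:
  fixes s :: "'a::field"
  assumes "s \<noteq> 0"
  shows "s ^ size A * (\<Prod>r\<in>#A. inverse s + r) = (\<Prod>r\<in>#A. 1 + s * r)"
proof (induction A)
  case (add x A)
  have "s ^ size (add_mset x A) * (\<Prod>r\<in>#add_mset x A. inverse s + r) =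
      (s * (inverse s + x)) * (s ^ size A * (\<Prod>r\<in>#A. inverse s + r))"
    by simp
  also have "s * (inverse s + x) = 1 + s * x"
    using assms by (simp add: distrib_left)
  finally show ?case using add by simp
qed simp

text \<open>For a form of degree \<open>N\<close>, moving away from \<open>a\<close> along \<open>v\<close> is, up to the factor \<open>s\<^sup>N\<close>, moving
from \<open>v\<close> along \<open>a\<close>. So \<open>g\<close> also splits on lines through \<open>a\<close>, whatever their direction. Concavity
of \<open>ln g\<close> and invariance under the edge are read off from this factorization.\<close>

lemma hyperbolic_direction_line:
  assumes hom: "\<And>c x. g (c *\<^sub>R x) = c ^ N * g x" and hyp: "hyperbolic_direction N g a"
  shows "\<exists>A. size A = N \<and> (\<forall>s. g (a + s *\<^sub>R v) = g a * (\<Prod>r\<in>#A. 1 + s * r))"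
proof -
  obtain A where A: "size A = N" "\<And>t. g (t *\<^sub>R a + v) = g a * (\<Prod>r\<in>#A. t + r)"
    using hyperbolic_directionE[OF hyp] by blast
  have "g (a + s *\<^sub>R v) = g a * (\<Prod>r\<in>#A. 1 + s * r)" for s
  proof (cases "s = 0")
    case False
    then have "g (a + s *\<^sub>R v) = s ^ N * g (inverse s *\<^sub>R a + v)"
      by (simp add: scaleR_add_right flip: hom)
    also have "\<dots> = g a * (s ^ size A * (\<Prod>r\<in>#A. inverse s + r))"
      by (simp add: A)
    finally show ?thesis
      using prod_mset_one_plus[OF False] by metis
  qed simp
  with A(1) show ?thesis by blast
qed

text \<open>The points of the half-open segment from \<open>x\<close> to \<open>e\<close> are positive multiples of the points of the
ray \<open>x + t e\<close>, and a form has the same sign on positive multiples.\<close>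

lemma closed_segment_positive_iff:
  fixes g :: "'a::real_vector \<Rightarrow> real"
  assumes hom: "\<And>c x. g (c *\<^sub>R x) = c ^ N * g x"
  shows "closed_segment x e \<subseteq> {x. g x > 0} \<longleftrightarrow> g e > 0 \<and> (\<forall>t\<ge>0. g (x + t *\<^sub>R e) > 0)"
    (is "?l \<longleftrightarrow> ?r")
proof
  assume l: ?l
  have "g (x + t *\<^sub>R e) > 0" if "t \<ge> 0" for t
  proof -
    have "(1 - t / (1 + t)) *\<^sub>R x + (t / (1 + t)) *\<^sub>R e \<in> closed_segment x e"
      unfolding closed_segment_def using that by auto
    moreover have "x + t *\<^sub>R e = (1 + t) *\<^sub>R ((1 - t / (1 + t)) *\<^sub>R x + (t / (1 + t)) *\<^sub>R e)"
      using that by (simp add: scaleR_add_right algebra_simps divide_simps)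
    ultimately show ?thesis
      using l that by (auto simp: hom)
  qed
  with l show ?r by auto
next
  assume r: ?r
  show ?l
  proof
    fix y assume "y \<in> closed_segment x e"
    then obtain u where u: "0 \<le> u" "u \<le> 1" "y = (1 - u) *\<^sub>R x + u *\<^sub>R e"
      unfolding closed_segment_def by blast
    show "y \<in> {x. g x > 0}"
    proof (cases "u = 1")
      case False
      with u have "y = (1 - u) *\<^sub>R (x + (u / (1 - u)) *\<^sub>R e)"
        by (simp add: scaleR_add_right)
      moreover have "g (x + (u / (1 - u)) *\<^sub>R e) > 0"
        using r u by simp
      ultimately show ?thesis
        using u False by (simp add: hom)
    qed (use r u in simp)
  qed
qed

lemma hyperbolic_direction_positive_roots:
  assumes hyp: "hyperbolic_direction N g e" and pos: "\<And>t. t \<ge> 0 \<Longrightarrow> g (x + t *\<^sub>R e) > 0"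
  shows "\<exists>A. size A = N \<and> (\<forall>r\<in>#A. r > 0) \<and> (\<forall>t. g (t *\<^sub>R e + x) = g e * (\<Prod>r\<in>#A. t + r))"
proof -
  obtain A where A: "size A = N" "\<And>t. g (t *\<^sub>R e + x) = g e * (\<Prod>r\<in>#A. t + r)"
    using hyperbolic_directionE[OF hyp] by blast
  have "r > 0" if "r \<in># A" for r
  proof (rule ccontr)
    assume "\<not> r > 0"
    moreover have "(\<Prod>q\<in>#A. - r + q) = 0"
      using that by (auto simp: prod_mset_zero_iff image_iff)
    moreover from this have "g (- r *\<^sub>R e + x) = 0"
      using A(2)[of "-r"] by (simp only: mult_zero_right)
    ultimately show False
      using pos[of "-r"] by (simp add: add.commute)
  qed
  with A show ?thesis by blast
qed

text \<open>On the ray, \<open>g(x + t e)\<close> is \<open>g(e)\<close> times a product of factors \<open>t + r\<close> with \<open>r > 0\<close>. The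
resulting lower bound \<open>g x\<close> is what prevents positivity along the ray from being lost in a limit
of points \<open>x\<close>.\<close>

lemma hyperbolic_direction_increasing:
  assumes hyp: "hyperbolic_direction N g e" and e: "g e > 0"
    and pos: "\<And>t. t \<ge> 0 \<Longrightarrow> g (x + t *\<^sub>R e) > 0" and t: "t \<ge> 0"
  shows "g x \<le> g (x + t *\<^sub>R e)"
proof -
  obtain A where A: "\<forall>r\<in>#A. r > 0" "\<And>t. g (t *\<^sub>R e + x) = g e * (\<Prod>r\<in>#A. t + r)"
    using hyperbolic_direction_positive_roots[OF hyp pos] by blast
  have "0 \<le> (\<Prod>r\<in>#A. r) \<and> (\<Prod>r\<in>#A. r) \<le> (\<Prod>r\<in>#A. t + r)"
    using A(1)
  proof (induction A)
    case (add q A)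
    then show ?case using t by (auto intro!: mult_mono)
  qed simp
  with e A(2)[of 0] A(2)[of t] show ?thesis
    by (simp add: add.commute mult_left_mono)
qed

lemma open_Collect_ball_compact:
  assumes "compact K" "open U" "continuous_on UNIV (\<lambda>(x, k). f x k)"
  shows "open {x. \<forall>k\<in>K. f x k \<in> U}"
proof (subst open_subopen, intro ballI)
  fix x0 assume "x0 \<in> {x. \<forall>k\<in>K. f x k \<in> U}"
  then have "{x0} \<times> K \<subseteq> (\<lambda>(x, k). f x k) -` U" by auto
  moreover have "open ((\<lambda>(x, k). f x k) -` U)"
    using assms by (simp add: open_vimage)
  ultimately obtain X where "x0 \<in> X" "open X" "X \<times> K \<subseteq> (\<lambda>(x, k). f x k) -` U"
    using Elementary_Topology.tube_lemma[OF assms(1), of "(\<lambda>(x, k). f x k) -` U" x0] by metis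
  then show "\<exists>T. open T \<and> x0 \<in> T \<and> T \<subseteq> {x. \<forall>k\<in>K. f x k \<in> U}"
    by (intro exI[of _ X]) auto
qed

text \<open>The component of a hyperbolic direction \<open>e\<close> is star-shaped about \<open>e\<close>. The set \<open>D\<close> of points
that see \<open>e\<close> within \<open>{g > 0}\<close> is contained in the component; it is open because a segment is
compact, and it is relatively closed because it is also described by the closed conditions
\<open>g x \<le> g(x + t e)\<close>. As it contains \<open>e\<close>, it is the whole component.

If every point of the component is a hyperbolic direction, this makes the component convex.\<close>

lemma positive_component_eq_segments:
  fixes g :: "'a::real_normed_vector \<Rightarrow> real"
  assumes cont: "continuous_on UNIV g" and hom: "\<And>c x. g (c *\<^sub>R x) = c ^ N * g x"
    and hyp: "hyperbolic_direction N g e"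
    and comp: "C \<in> components {x. g x > 0}" and e: "e \<in> C"
  shows "C = {x. closed_segment x e \<subseteq> {x. g x > 0}}"
proof -
  define D where "D = {x. closed_segment x e \<subseteq> {x. g x > 0}}"
  have C_pos: "C \<subseteq> {x. g x > 0}"
    using comp by (rule in_components_subset)
  with e have ge: "g e > 0" by auto
  have D_C: "D \<subseteq> C"
  proof
    fix x assume "x \<in> D"
    then have "closed_segment x e \<subseteq> {x. g x > 0}" by (simp add: D_def)
    then have "closed_segment x e \<subseteq> C"
      using components_maximal[OF comp connected_segment(1)] e by blast
    then show "x \<in> C" by auto
  qed
  have "D = {x. \<forall>u\<in>{0..1}. g ((1 - u) *\<^sub>R x + u *\<^sub>R e) \<in> {0<..}}"
    by (fastforce simp: D_def closed_segment_def)
  also have "open \<dots>"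
    by (rule open_Collect_ball_compact)
      (auto simp: case_prod_beta intro!: continuous_intros continuous_on_compose2[OF cont])
  finally have "openin (top_of_set C) D"
    using D_C by (rule open_subset[rotated])
  moreover have "D = C \<inter> (\<Inter>t\<in>{0..}. {x. g x \<le> g (x + t *\<^sub>R e)})" (is "D = ?R")
  proof
    show "D \<subseteq> ?R"
    proof
      fix x assume x: "x \<in> D"
      then have "\<And>t. t \<ge> 0 \<Longrightarrow> g (x + t *\<^sub>R e) > 0"
        using closed_segment_positive_iff[of g N x e] hom by (simp add: D_def)
      with hyperbolic_direction_increasing[OF hyp ge this] x D_C show "x \<in> ?R" by auto
    qed
    show "?R \<subseteq> D"
    proof
      fix x assume x: "x \<in> ?R"
      then have "g x > 0" using C_pos by auto
      with x have "g (x + t *\<^sub>R e) > 0" if "t \<ge> 0" for t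
        using that by (fastforce intro: less_le_trans)
      with ge show "x \<in> D"
        using closed_segment_positive_iff[of g N x e] hom by (simp add: D_def)
    qed
  qed
  moreover have "closed (\<Inter>t\<in>{0..}. {x. g x \<le> g (x + t *\<^sub>R e)})"
    by (intro closed_INT ballI closed_Collect_le cont continuous_on_compose2[OF cont])
      (auto intro!: continuous_intros)
  ultimately have "closedin (top_of_set C) D"
    by (metis closedin_closed_Int)
  moreover have "e \<in> D" using ge by (simp add: D_def)
  moreover have "connected C" using comp by (rule in_components_connected)
  ultimately have "D = {} \<or> D = C"
    using \<open>openin (top_of_set C) D\<close> unfolding connected_clopen by metis
  with \<open>e \<in> D\<close> have "C = D" by auto
  then show ?thesis unfolding D_def .
qed

text \<open>Hyperbolicity spreads over the component (Garding). Let \<open>G(x, y, z)\<close> be the complexification of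
\<open>g(x e + y a + z v)\<close>, and consider the zeros \<open>t\<close> of \<open>G(\<i>, t, s)\<close> as the real parameter \<open>s\<close> moves.
None of them can be real, because \<open>e\<close> is hyperbolic and \<open>\<i>\<close> is not real. For \<open>s = 0\<close> they all lie
in the open lower half-plane, since \<open>g\<close> is positive on the segment from \<open>a\<close> to \<open>e\<close>. Their number
stays \<open>N\<close>, since the leading coefficient in \<open>t\<close> is \<open>g a \<noteq> 0\<close>. So no zero can cross into the upper
half-plane, for any \<open>s\<close>. By homogeneity the same holds for \<open>G(c \<i>, t, s)\<close> with \<open>c > 0\<close>; in the
limit \<open>c \<rightarrow> 0\<close> the zeros of \<open>g(t a + s v)\<close> lie in the closed lower half-plane, and replacing
\<open>(t, s)\<close> by \<open>(-t, -s)\<close> shows that they are real.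

That no zero crosses comes from a quantitative bound: if \<open>G(w, t, z)\<close> has all its zeros \<open>t\<close> in
the open lower half-plane, then \<open>\<bar>G(w, t, z)\<bar> \<ge> g(a) (Im t)\<^sup>N\<close> for \<open>t\<close> in the upper half-plane.
This inequality passes to limits in \<open>w\<close> and \<open>z\<close>.\<close>

lemma hyperbolic_direction_if_segment_positive:
  fixes g :: "'a::real_normed_vector \<Rightarrow> real"
  assumes poly: "real_polynomial_function g" and hom: "\<And>c x. g (c *\<^sub>R x) = c ^ N * g x"
    and hyp: "hyperbolic_direction N g e" and seg: "closed_segment a e \<subseteq> {x. g x > 0}"
  shows "hyperbolic_direction N g a"
  unfolding hyperbolic_direction_def
proof
  fix v
  have ge: "g e > 0" and a: "\<And>t. t \<ge> 0 \<Longrightarrow> g (a + t *\<^sub>R e) > 0"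
    using seg closed_segment_positive_iff[of g N a e] hom by auto
  from a[of 0] have ga: "g a > 0" by simp
  obtain G where G: "complex_polynomial3 G"
    and G_real: "\<And>x y z. G (of_real x) (of_real y) (of_real z) = of_real (g (x *\<^sub>R e + y *\<^sub>R a + z *\<^sub>R v))"
    using complexification_exists[OF poly] by blast
  have G_hom: "G (c * x) (c * y) (c * z) = c ^ N * G x y z" for c x y z
  proof (rule complex_polynomial3_homogeneous[OF G])
    fix c x y z :: real
    have "(c * x) *\<^sub>R e + (c * y) *\<^sub>R a + (c * z) *\<^sub>R v = c *\<^sub>R (x *\<^sub>R e + y *\<^sub>R a + z *\<^sub>R v)"
      by (simp add: scaleR_add_right)
    then show "G (of_real (c * x)) (of_real (c * y)) (of_real (c * z)) =
        of_real c ^ N * G (of_real x) (of_real y) (of_real z)"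
      by (simp only: G_real hom) simp
  qed
  have G_cont: "continuous_on UNIV (\<lambda>w. G (f w) (h w) (k w))"
    if "continuous_on UNIV f" "continuous_on UNIV h" "continuous_on UNIV k"
    for f h k :: "'b::topological_space \<Rightarrow> complex"
    using that by (rule complex_polynomial3_continuous[OF G])
  have G_e: "G w (of_real y) (of_real z) = of_real (g e) * (\<Prod>r\<in>#A. w + of_real r)"
    if "\<And>t. g (t *\<^sub>R e + (y *\<^sub>R a + z *\<^sub>R v)) = g e * (\<Prod>r\<in>#A. t + r)" for w y z A
  proof -
    obtain p where p: "\<And>w. G w (of_real y) (of_real z) = poly p w"
      using complex_polynomial3_lineE[OF G, of 0 1 "of_real y" 0 "of_real z" 0] by auto
    have "p = smult (of_real (g e)) (\<Prod>r\<in>#A. [:of_real r, 1:])"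
    proof (rule poly_eq_if_eq_on_reals)
      fix t :: real
      have "complex_of_real (\<Prod>r\<in>#A. t + r) = (\<Prod>r\<in>#A. of_real t + of_real r)"
        by (induction A) auto
      then show "poly p (of_real t) =
          poly (smult (of_real (g e)) (\<Prod>r\<in>#A. [:of_real r, 1:])) (of_real t)"
        using that[of t] by (simp add: G_real poly_prod_mset_linear add.assoc flip: p)
    qed
    then show ?thesis
      by (simp add: p poly_prod_mset_linear)
  qed
  have G_nonreal: "G w (of_real y) (of_real z) \<noteq> 0" if "Im w \<noteq> 0" for w y z
  proof -
    obtain A where "\<And>t. g (t *\<^sub>R e + (y *\<^sub>R a + z *\<^sub>R v)) = g e * (\<Prod>r\<in>#A. t + r)"
      using hyperbolic_directionE[OF hyp] by blast
    moreover have "w + of_real r \<noteq> 0" for r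
      using that by (simp add: complex_eq_iff)
    ultimately show ?thesis
      using ge by (simp add: G_e[of y z A] prod_mset_zero_iff image_iff)
  qed
  have G_plane: "G \<i> t 0 \<noteq> 0" if "Im t \<ge> 0" for t
  proof (cases "t = 0")
    case True
    then show ?thesis using G_nonreal[of \<i> 0 0] by simp
  next
    case False
    obtain A where A: "\<forall>r\<in>#A. r > 0" "\<And>t. g (t *\<^sub>R e + a) = g e * (\<Prod>r\<in>#A. t + r)"
      using hyperbolic_direction_positive_roots[OF hyp a] by blast
    have "\<i> / t + of_real r \<noteq> 0" if "r > 0" for r :: real
    proof
      assume "\<i> / t + of_real r = 0"
      with False have "\<i> + of_real r * t = 0" by (simp add: field_simps)
      then have "1 + r * Im t = 0" by (simp add: complex_eq_iff)
      moreover have "r * Im t \<ge> 0" using that \<open>Im t \<ge> 0\<close> by simp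
      ultimately show False by simp
    qed
    then have "G (\<i> / t) (of_real 1) (of_real 0) \<noteq> 0"
      using A(1) ge by (subst G_e[of 1 0 A]) (auto simp: A(2) prod_mset_zero_iff)
    with False G_hom[of t "\<i> / t" 1 0] show ?thesis by simp
  qed
  have G_a: "G 0 1 0 = of_real (g a)"
    using G_real[of 0 1 0] by simp
  have G_factor: "\<exists>B. size B = N \<and> (\<forall>t. G w t z = of_real (g a) * (\<Prod>r\<in>#B. t + r))" for w z
  proof -
    obtain p where p: "\<And>t. G w t z = poly p t"
      using complex_polynomial3_lineE[OF G, of w 0 0 1 z 0] by auto
    let ?h = "\<lambda>u. G (u * w) 1 (u * z)"
    have eq: "poly p t = t ^ N * ?h (inverse t)" if "t \<noteq> 0" for t
      using that G_hom[of t "inverse t * w" 1 "inverse t * z"] by (simp flip: p mult.assoc)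
    have "continuous_on UNIV ?h"
      by (intro G_cont continuous_intros)
    then have "isCont ?h 0"
      by (simp add: continuous_on_eq_continuous_at)
    from degree_lead_coeff_homogeneousI[OF eq this] ga
    have deg: "degree p = N" "lead_coeff p = of_real (g a)" by (auto simp: G_a)
    have "p = smult (of_real (g a)) (\<Prod>r\<in>#proots p. [:- r, 1:])"
      using complex_poly_decompose_multiset[of p] deg by simp
    then have "G w t z = of_real (g a) * (\<Prod>r\<in>#image_mset uminus (proots p). t + r)" for t
      using poly_prod_mset_linear[of uminus "proots p" t]
      by (simp add: p multiset.map_comp o_def) (metis poly_smult)
    then show ?thesis
      using deg size_proots_complex[of p]
      by (intro exI[of _ "image_mset uminus (proots p)"]) simp
  qed
  have G_bound: "g a * Im t ^ N \<le> norm (G w t z)"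
    if nz: "\<And>t. Im t \<ge> 0 \<Longrightarrow> G w t z \<noteq> 0" and t: "Im t \<ge> 0" for w t z
  proof -
    obtain B where B: "size B = N" "\<And>t. G w t z = of_real (g a) * (\<Prod>r\<in>#B. t + r)"
      using G_factor by blast
    have "Im r > 0" if "r \<in># B" for r
    proof (rule ccontr)
      assume "\<not> Im r > 0"
      moreover have "(\<Prod>q\<in>#B. - r + q) = 0"
        using that by (auto simp: prod_mset_zero_iff image_iff)
      ultimately show False
        using nz[of "-r"] B(2)[of "-r"] by simp
    qed
    then have "Im t ^ size B \<le> norm (\<Prod>r\<in>#B. t + r)"
    proof (induction B)
      case (add q B)
      have "Im t \<le> norm (t + q)"
        using add.prems[of q] abs_Im_le_cmod[of "t + q"] by simp
      then have "Im t * Im t ^ size B \<le> norm (t + q) * norm (\<Prod>r\<in>#B. t + r)"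
        using t add by (intro mult_mono) auto
      then show ?case by (simp add: norm_mult)
    qed simp
    then show ?thesis
      using ga by (simp add: B norm_mult mult_left_mono)
  qed
  \<comment> \<open>The set of good parameters is closed by the bound just proved, and open because the
    closed upper half-plane has a compactification \<open>K\<close> to which the condition extends; the
    real line is connected.\<close>
  define T where "T = {s::real. \<forall>t. Im t \<ge> 0 \<longrightarrow> G \<i> t (of_real s) \<noteq> 0}"
  have "T = UNIV"
  proof -
    have "T = (\<Inter>t\<in>{t. Im t > 0}. {s. g a * Im t ^ N \<le> norm (G \<i> t (of_real s))})"
    proof (intro equalityI subsetI)
      fix s assume "s \<in> (\<Inter>t\<in>{t. Im t > 0}. {s. g a * Im t ^ N \<le> norm (G \<i> t (of_real s))})"
      then have s: "g a * Im t ^ N \<le> norm (G \<i> t (of_real s))" if "Im t > 0" for t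
        using that by auto
      have "G \<i> t (of_real s) \<noteq> 0" if "Im t \<ge> 0" for t
      proof (cases "Im t = 0")
        case True
        then have "t = of_real (Re t)" by (simp add: complex_eq_iff)
        with G_nonreal[of \<i> "Re t" s] show ?thesis by simp
      next
        case False
        with that have "Im t > 0" by simp
        with s[OF this] ga show ?thesis
          by (metis norm_zero mult_pos_pos not_le zero_less_power)
      qed
      then show "s \<in> T" by (simp add: T_def)
    qed (auto simp: T_def G_bound)
    moreover have "closed \<dots>"
      by (intro closed_INT ballI closed_Collect_le continuous_intros G_cont)
    ultimately have "closed T" by simp
    \<comment> \<open>The point \<open>(1, t)\<close> represents \<open>t\<close>; points with first coordinate \<open>0\<close> are at infinity, where
      \<open>G\<close> reduces to \<open>t\<^sup>N g(a)\<close>.\<close>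
    define K where "K = sphere (0 :: real \<times> complex) 1 \<inter> {k. 0 \<le> fst k} \<inter> {k. 0 \<le> Im (snd k)}"
    have "compact K"
      unfolding K_def
      by (intro compact_Int_closed compact_sphere closed_Collect_le continuous_intros)
    have "T = {s. \<forall>k\<in>K. G (of_real (fst k) * \<i>) (snd k) (of_real (fst k) * of_real s) \<in> - {0}}"
    proof (intro equalityI subsetI)
      fix s assume s: "s \<in> T"
      have "G (of_real c * \<i>) t (of_real c * of_real s) \<noteq> 0" if "(c, t) \<in> K" for c t
      proof (cases "c = 0")
        case True
        with that have "t \<noteq> 0" by (auto simp: K_def)
        with True G_hom[of t 0 1 0] ga show ?thesis by (simp add: G_a)
      next
        case False
        with that have "c > 0" "Im (t / of_real c) \<ge> 0" by (auto simp: K_def)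
        then have "G \<i> (t / of_real c) (of_real s) \<noteq> 0" using s by (simp add: T_def)
        with \<open>c > 0\<close> G_hom[of "of_real c" \<i> "t / of_real c" "of_real s"] show ?thesis by simp
      qed
      then show "s \<in> {s. \<forall>k\<in>K. G (of_real (fst k) * \<i>) (snd k) (of_real (fst k) * of_real s) \<in> - {0}}"
        by auto
    next
      fix s assume s: "s \<in> {s. \<forall>k\<in>K. G (of_real (fst k) * \<i>) (snd k) (of_real (fst k) * of_real s) \<in> - {0}}"
      have "G \<i> t (of_real s) \<noteq> 0" if "Im t \<ge> 0" for t
      proof -
        define c where "c = inverse (norm (1::real, t))"
        have "(1::real, t) \<noteq> 0" by (simp add: zero_prod_def)
        then have c: "c > 0" "norm (c *\<^sub>R (1::real, t)) = 1" by (auto simp: c_def simp del: scaleR_Pair)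
        then have "(c, of_real c * t) \<in> K"
          using that by (simp add: K_def scaleR_conv_of_real)
        with s have "G (of_real c * \<i>) (of_real c * t) (of_real c * of_real s) \<noteq> 0" by auto
        then show ?thesis by (simp add: G_hom)
      qed
      then show "s \<in> T" by (simp add: T_def)
    qed
    also have "open \<dots>"
      using \<open>compact K\<close>
      by (rule open_Collect_ball_compact)
        (auto simp: case_prod_beta intro!: G_cont continuous_intros)
    finally have "open T" .
    moreover have "0 \<in> T" using G_plane by (simp add: T_def)
    ultimately show ?thesis using \<open>closed T\<close> clopen[of T] by auto
  qed
  have G_small: "G (of_real c * \<i>) t (of_real s) \<noteq> 0" if "c > 0" "Im t \<ge> 0" for c s t
  proof -
    have "s / c \<in> T" using \<open>T = UNIV\<close> by simp
    moreover have "Im (t / of_real c) \<ge> 0" using that by simp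
    ultimately have "G \<i> (t / of_real c) (of_real (s / c)) \<noteq> 0" unfolding T_def by blast
    with that G_hom[of "of_real c" \<i> "t / of_real c" "of_real (s / c)"] show ?thesis by simp
  qed
  have G_Im: "Im t \<le> 0" if zero: "G 0 t (of_real s) = 0" for t s
  proof (rule ccontr)
    assume "\<not> Im t \<le> 0"
    have "continuous_on UNIV (\<lambda>c. norm (G (of_real c * \<i>) t (of_real s)))"
      by (intro continuous_intros G_cont)
    then have "isCont (\<lambda>c. norm (G (of_real c * \<i>) t (of_real s))) 0"
      by (simp add: continuous_on_eq_continuous_at)
    then have "((\<lambda>c. norm (G (of_real c * \<i>) t (of_real s))) \<longlongrightarrow> norm (G 0 t (of_real s))) (at_right 0)"
      unfolding isCont_def by (auto intro: tendsto_within_subset)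
    moreover have "\<forall>\<^sub>F c in at_right 0. g a * Im t ^ N \<le> norm (G (of_real c * \<i>) t (of_real s))"
      using eventually_at_right_less[of "0::real"]
      by eventually_elim (use G_small \<open>\<not> Im t \<le> 0\<close> in \<open>auto intro!: G_bound\<close>)
    ultimately have "g a * Im t ^ N \<le> norm (G 0 t (of_real s))"
      by (rule tendsto_lowerbound) simp
    moreover have "g a * Im t ^ N > 0"
      using ga \<open>\<not> Im t \<le> 0\<close> by simp
    ultimately show False using zero by simp
  qed
  obtain B where B: "size B = N" "\<And>t. G 0 t 1 = of_real (g a) * (\<Prod>r\<in>#B. t + r)"
    using G_factor by blast
  have real: "of_real (Re r) = r" if "r \<in># B" for r
  proof -
    have "(\<Prod>q\<in>#B. - r + q) = 0"
      using that by (auto simp: prod_mset_zero_iff image_iff)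
    then have "G 0 (- r) 1 = 0" using B(2) by simp
    moreover from this have "G 0 r (-1) = 0" using G_hom[of "-1" 0 "- r" 1] by simp
    ultimately show ?thesis
      using G_Im[of "-r" 1] G_Im[of r "-1"] by (simp add: complex_eq_iff)
  qed
  have "g (t *\<^sub>R a + v) = g a * (\<Prod>r\<in>#image_mset Re B. t + r)" for t
  proof -
    have "of_real (\<Prod>r\<in>#image_mset Re B. t + r) = (\<Prod>r\<in>#B. of_real t + r)"
      using real by (induction B) auto
    moreover have "complex_of_real (g (t *\<^sub>R a + v)) = G 0 (of_real t) 1"
      using G_real[of 0 t 1] by simp
    ultimately have "complex_of_real (g (t *\<^sub>R a + v)) =
        of_real (g a * (\<Prod>r\<in>#image_mset Re B. t + r))"
      by (simp add: B)
    then show ?thesis by (simp only: of_real_eq_iff)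
  qed
  with B(1) show "\<exists>A. size A = N \<and> (\<forall>t. g (t *\<^sub>R a + v) = g a * (\<Prod>r\<in>#A. t + r))"
    by (intro exI[of _ "image_mset Re B"]) simp
qed

section \<open>Convexity of the cone and concavity of the logarithm\<close>

lemma garding_polynomial_continuous:
  assumes "garding_polynomial N g \<Gamma>"
  shows "continuous_on S g"
  using assms continuous_on_polymonial_function
  by (auto simp: garding_polynomial_def homogeneous_polynomial_def real_polynomial_function_eq)

lemma garding_polynomial_homogeneous:
  assumes "garding_polynomial N g \<Gamma>"
  shows "g (c *\<^sub>R x) = c ^ N * g x"
  using assms by (simp add: garding_polynomial_def homogeneous_polynomial_def)

lemma garding_polynomial_component:
  assumes "garding_polynomial N g \<Gamma>"
  shows "\<Gamma> \<in> components {x. g x > 0}"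
  using assms by (simp add: garding_polynomial_def)

lemma garding_cone_positive:
  assumes "garding_polynomial N g \<Gamma>" "x \<in> \<Gamma>"
  shows "g x > 0"
  using in_components_subset[OF garding_polynomial_component[OF assms(1)]] assms(2) by auto

lemma garding_cone_nonempty:
  assumes "garding_polynomial N g \<Gamma>"
  shows "\<Gamma> \<noteq> {}"
  using assms by (auto simp: garding_polynomial_def)

lemma garding_cone_open:
  assumes "garding_polynomial N g \<Gamma>"
  shows "open \<Gamma>"
proof (rule open_components[OF _ garding_polynomial_component[OF assms]])
  show "open {x. g x > 0}"
    by (intro open_Collect_less continuous_on_const garding_polynomial_continuous[OF assms])
qed

text \<open>A component is relatively closed in \<open>{g > 0}\<close>, so \<open>g\<close> vanishes on its boundary. A
limit of points of the cone at which \<open>g\<close> is still positive is therefore in the cone.\<close>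

lemma garding_cone_closure_positive:
  assumes "garding_polynomial N g \<Gamma>" "x \<in> closure \<Gamma>" "g x > 0"
  shows "x \<in> \<Gamma>"
proof -
  have "closedin (top_of_set {x. g x > 0}) \<Gamma>"
    by (rule closedin_component[OF garding_polynomial_component[OF assms(1)]])
  then obtain T where T: "closed T" "\<Gamma> = {x. g x > 0} \<inter> T"
    by (auto simp: closedin_closed)
  then have "closure \<Gamma> \<subseteq> T" by (intro closure_minimal) auto
  with T assms show ?thesis by auto
qed

lemma garding_cone_scale:
  assumes "garding_polynomial N g \<Gamma>" "x \<in> \<Gamma>" "c > 0"
  shows "c *\<^sub>R x \<in> \<Gamma>"
proof -
  have pos: "g (d *\<^sub>R x) > 0" if "d > 0" for d
    using that garding_cone_positive[OF assms(1,2)]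
    by (simp add: garding_polynomial_homogeneous[OF assms(1)])
  have "connected ((\<lambda>d. d *\<^sub>R x) ` {0<..})"
    by (intro connected_continuous_image continuous_intros) auto
  moreover have "(\<lambda>d. d *\<^sub>R x) ` {0<..} \<subseteq> {x. g x > 0}"
    using pos by auto
  moreover have "1 *\<^sub>R x \<in> (\<lambda>d. d *\<^sub>R x) ` {0<..}" by (rule imageI) simp
  ultimately have "(\<lambda>d. d *\<^sub>R x) ` {0<..} \<subseteq> \<Gamma>"
    using components_maximal[OF garding_polynomial_component[OF assms(1)]] assms(2) by fastforce
  with assms(3) show ?thesis by auto
qed

lemma garding_cone_hyperbolic:
  assumes gard: "garding_polynomial N g \<Gamma>" and a: "a \<in> \<Gamma>"
  shows "hyperbolic_direction N g a"
proof -
  obtain e where e: "e \<in> \<Gamma>"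
    and roots: "\<And>v. \<exists>p. (\<forall>t. poly p t = g (t *\<^sub>R e + v)) \<and> p \<noteq> 0 \<and> size (proots p) = N"
    using gard unfolding garding_polynomial_def by blast
  note cont = garding_polynomial_continuous[OF gard]
  note hom = garding_polynomial_homogeneous[OF gard]
  have "g e \<noteq> 0" using garding_cone_positive[OF gard e] by simp
  then have hyp: "hyperbolic_direction N g e"
    using hyperbolic_directionI_proots[OF cont hom _ roots] by blast
  have "closed_segment a e \<subseteq> {x. g x > 0}"
    using positive_component_eq_segments[OF cont hom hyp garding_polynomial_component[OF gard] e] a
    by blast
  moreover have "real_polynomial_function g"
    using gard by (simp add: garding_polynomial_def homogeneous_polynomial_def)
  ultimately show ?thesis
    using hyperbolic_direction_if_segment_positive[OF _ hom hyp] by blast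
qed

lemma garding_cone_convex:
  assumes gard: "garding_polynomial N g \<Gamma>"
  shows "convex \<Gamma>"
proof (rule convexI)
  fix x y and u v :: real
  assume xy: "x \<in> \<Gamma>" "y \<in> \<Gamma>" and uv: "0 \<le> u" "0 \<le> v" "u + v = 1"
  note comp = garding_polynomial_component[OF gard]
  have "closed_segment x y \<subseteq> {x. g x > 0}"
    using positive_component_eq_segments[OF garding_polynomial_continuous[OF gard]
        garding_polynomial_homogeneous[OF gard] garding_cone_hyperbolic[OF gard xy(2)] comp xy(2)] xy(1)
    by blast
  then have "closed_segment x y \<subseteq> \<Gamma>"
    using components_maximal[OF comp connected_segment(1)] xy by blast
  moreover have "u *\<^sub>R x + v *\<^sub>R y \<in> closed_segment x y"
  proof -
    have "u = 1 - v" using uv(3) by simp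
    with uv(1,2) show ?thesis
      unfolding closed_segment_def by (intro CollectI exI[of _ v]) simp
  qed
  ultimately show "u *\<^sub>R x + v *\<^sub>R y \<in> \<Gamma>" by blast
qed

lemma prod_mset_pos:
  fixes f :: "'b \<Rightarrow> 'a::linordered_idom"
  assumes "\<And>r. r \<in># A \<Longrightarrow> f r > 0"
  shows "(\<Prod>r\<in>#A. f r) > 0"
  using assms by (induction A) auto

text \<open>Concavity of \<open>ln\<close> between \<open>1\<close> and \<open>1 + r\<close>, summed over the factors.\<close>

lemma ln_prod_mset_one_plus:
  fixes s :: real
  assumes "\<And>r. r \<in># A \<Longrightarrow> 1 + r > 0" "0 \<le> s" "s \<le> 1"
  shows "(\<Prod>r\<in>#A. 1 + s * r) > 0 \<and> s * ln (\<Prod>r\<in>#A. 1 + r) \<le> ln (\<Prod>r\<in>#A. 1 + s * r)"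
  using assms(1)
proof (induction A)
  case (add q A)
  have "1 + 1 * q > 0" using add.prems by simp
  have pos: "1 + s * q > 0"
  proof -
    have "1 + s * q = (1 - s) + s * (1 + q)" by (simp add: algebra_simps)
    also have "\<dots> > 0"
      using add.prems[of q] assms(2,3) by (cases "s = 1") (auto intro: add_pos_nonneg)
    finally show ?thesis .
  qed
  have "s * ln (1 + q) \<le> ln (1 + s * q)"
    using concave_onD[OF ln_concave, of s 1 "1 + q"] assms(2,3) add.prems[of q]
    by (simp add: algebra_simps)
  moreover have IH: "(\<Prod>r\<in>#A. 1 + s * r) > 0"
    "s * ln (\<Prod>r\<in>#A. 1 + r) \<le> ln (\<Prod>r\<in>#A. 1 + s * r)"
    using add by auto
  moreover have "ln ((1 + q) * (\<Prod>r\<in>#A. 1 + r)) = ln (1 + q) + ln (\<Prod>r\<in>#A. 1 + r)"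
    using add.prems by (intro ln_mult_pos prod_mset_pos) auto
  moreover have "ln ((1 + s * q) * (\<Prod>r\<in>#A. 1 + s * r)) = ln (1 + s * q) + ln (\<Prod>r\<in>#A. 1 + s * r)"
    by (intro ln_mult_pos pos IH)
  ultimately show ?case
    using mult_pos_pos[OF pos IH(1)] by (simp add: distrib_left)
qed simp

text \<open>Along a segment from \<open>x\<close> to \<open>z\<close> inside the cone, \<open>g\<close> is \<open>g x\<close> times a product of real affine
factors \<open>1 + s r\<close>, none of which vanishes for \<open>0 \<le> s \<le> 1\<close>. So \<open>ln g\<close> is a sum of concave
functions of \<open>s\<close>.\<close>

lemma garding_concave_ln:
  assumes gard: "garding_polynomial N g \<Gamma>"
  shows "concave_on \<Gamma> (\<lambda>x. ln (g x))"
  unfolding concave_on_iff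
proof (intro conjI ballI allI impI garding_cone_convex[OF gard])
  fix x z and u s :: real
  assume xz: "x \<in> \<Gamma>" "z \<in> \<Gamma>" and us: "0 \<le> u" "0 \<le> s" "u + s = 1"
  obtain A where A: "\<And>s. g (x + s *\<^sub>R (z - x)) = g x * (\<Prod>r\<in>#A. 1 + s * r)"
    using hyperbolic_direction_line[OF garding_polynomial_homogeneous[OF gard]
        garding_cone_hyperbolic[OF gard xz(1)]] by blast
  have gx: "g x > 0" and gz: "g z > 0"
    using garding_cone_positive[OF gard] xz by auto
  have "1 + r > 0" if "r \<in># A" for r
  proof (rule ccontr)
    assume "\<not> 1 + r > 0"
    then have r: "r \<le> -1" by simp
    \<comment> \<open>A factor with \<open>r \<le> -1\<close> would vanish at the point \<open>s = -1/r\<close> of the segment.\<close>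
    have "x + (- 1 / r) *\<^sub>R (z - x) = (1 + 1 / r) *\<^sub>R x + (- 1 / r) *\<^sub>R z"
      by (simp add: algebra_simps)
    also have "\<dots> \<in> \<Gamma>"
      using r by (intro convexD[OF garding_cone_convex[OF gard] xz]) (auto simp: field_simps)
    finally have "g (x + (- 1 / r) *\<^sub>R (z - x)) > 0"
      by (rule garding_cone_positive[OF gard])
    moreover have "(\<Prod>q\<in>#A. 1 + (- 1 / r) * q) = 0"
      using that r by (auto simp: prod_mset_zero_iff image_iff intro!: bexI[of _ r])
    ultimately show False unfolding A by (metis mult_zero_right less_irrefl)
  qed
  from ln_prod_mset_one_plus[OF this, of A s] ln_prod_mset_one_plus[OF this, of A 1] us
  have pos: "(\<Prod>r\<in>#A. 1 + s * r) > 0" "(\<Prod>r\<in>#A. 1 + r) > 0"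
    and le: "s * ln (\<Prod>r\<in>#A. 1 + r) \<le> ln (\<Prod>r\<in>#A. 1 + s * r)" by auto
  have u: "u = 1 - s" using us by simp
  have "g z = g x * (\<Prod>r\<in>#A. 1 + r)"
    using A[of 1] by simp
  then have "ln (g z) = ln (g x) + ln (\<Prod>r\<in>#A. 1 + r)"
    using gx pos(2) by (simp add: ln_mult_pos)
  then have "u * ln (g x) + s * ln (g z) = ln (g x) + s * ln (\<Prod>r\<in>#A. 1 + r)"
    by (simp add: u algebra_simps)
  also have "\<dots> \<le> ln (g x) + ln (\<Prod>r\<in>#A. 1 + s * r)"
    using le by simp
  also have "\<dots> = ln (g (x + s *\<^sub>R (z - x)))"
    using gx pos(1) by (simp add: A ln_mult_pos)
  also have "x + s *\<^sub>R (z - x) = u *\<^sub>R x + s *\<^sub>R z"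
    unfolding u by (simp add: algebra_simps)
  finally show "u * ln (g x) + s * ln (g z) \<le> ln (g (u *\<^sub>R x + s *\<^sub>R z))" .
qed

lemma has_derivative_imp_DERIV_line:
  fixes f :: "'a::real_normed_vector \<Rightarrow> real"
  assumes "(f has_derivative f') (at x)"
  shows "((\<lambda>s. f (x + s *\<^sub>R v)) has_field_derivative f' v) (at 0)"
proof -
  interpret f': bounded_linear f'
    using assms by (rule has_derivative_bounded_linear)
  have "((\<lambda>s. x + s *\<^sub>R v) has_derivative (\<lambda>s. s *\<^sub>R v)) (at 0)"
    by (intro derivative_eq_intros) auto
  then have "((\<lambda>s. f (x + s *\<^sub>R v)) has_derivative (\<lambda>s. f' (s *\<^sub>R v))) (at 0)"
    by (rule has_derivative_compose) (simp add: assms)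
  then show ?thesis
    by (simp add: has_field_derivative_def f'.scaleR mult_commute_abs)
qed

lemma concave_on_imp_below_tangent:
  fixes f :: "'a::real_normed_vector \<Rightarrow> real"
  assumes conc: "concave_on S f" and x: "x \<in> S" and z: "z \<in> S"
    and deriv: "(f has_derivative f') (at x)"
  shows "f z \<le> f x + f' (z - x)"
proof -
  have "((\<lambda>s. (f (x + s *\<^sub>R (z - x)) - f x) / s) \<longlongrightarrow> f' (z - x)) (at 0)"
    using has_derivative_imp_DERIV_line[OF deriv, of "z - x"] by (simp add: DERIV_def)
  then have "((\<lambda>s. (f (x + s *\<^sub>R (z - x)) - f x) / s) \<longlongrightarrow> f' (z - x)) (at_right 0)"
    by (rule tendsto_within_subset) simp
  moreover have "\<forall>\<^sub>F s in at_right 0. f z - f x \<le> (f (x + s *\<^sub>R (z - x)) - f x) / s"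
    using eventually_at_right_real[of 0 "1::real"]
  proof (rule eventually_mono)
    fix s :: real assume s: "s \<in> {0<..<1}"
    have "(1 - s) *\<^sub>R x + s *\<^sub>R z = x + s *\<^sub>R (z - x)"
      by (simp add: algebra_simps)
    with s concave_onD[OF conc, of s x z] x z
    have "(1 - s) * f x + s * f z \<le> f (x + s *\<^sub>R (z - x))" by simp
    with s show "f z - f x \<le> (f (x + s *\<^sub>R (z - x)) - f x) / s"
      by (simp add: field_simps)
  qed simp
  ultimately have "f z - f x \<le> f' (z - x)"
    by (rule tendsto_lowerbound) simp
  then show ?thesis by simp
qed

lemma garding_ln_euler:
  assumes gard: "garding_polynomial N g \<Gamma>" and x: "x \<in> \<Gamma>"
    and deriv: "((\<lambda>z. ln (g z)) has_derivative f') (at x)"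
  shows "f' x = real N"
proof -
  have "((\<lambda>s. real N * ln (1 + s) + ln (g x)) has_field_derivative real N) (at 0)"
    by (auto intro!: derivative_eq_intros)
  then have "((\<lambda>s. ln (g (x + s *\<^sub>R x))) has_field_derivative real N) (at 0)"
  proof (rule has_field_derivative_transform_within_open[of _ _ _ "{-1<..}"])
    fix s :: real assume "s \<in> {-1<..}"
    moreover have "x + s *\<^sub>R x = (1 + s) *\<^sub>R x" by (simp add: algebra_simps)
    ultimately show "real N * ln (1 + s) + ln (g x) = ln (g (x + s *\<^sub>R x))"
      using garding_cone_positive[OF gard x]
      by (simp add: garding_polynomial_homogeneous[OF gard] ln_mult_pos ln_realpow)
  qed auto
  with has_derivative_imp_DERIV_line[OF deriv, of x] show ?thesis
    by (metis DERIV_unique)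
qed

lemma garding_gradient_eq_iff:
  assumes gard: "garding_polynomial N g \<Gamma>" and x: "x \<in> \<Gamma>"
  shows "garding_gradient g x = y \<longleftrightarrow> ((\<lambda>z. ln (g z)) has_derivative blinfun_apply y) (at x)"
proof
  have "real_polynomial_function g"
    using gard by (simp add: garding_polynomial_def homogeneous_polynomial_def)
  then obtain D where "(g has_derivative D) (at x)"
    using differentiable_at_real_polynomial_function unfolding differentiable_def by blast
  then have "(\<lambda>z. ln (g z)) differentiable at x"
    using has_derivative_ln[of g x, OF garding_cone_positive[OF gard x]] unfolding differentiable_def by blast
  then have "((\<lambda>z. ln (g z)) has_derivative frechet_derivative (\<lambda>z. ln (g z)) (at x)) (at x)"
    by (simp add: frechet_derivative_works)
  moreover from this have "blinfun_apply (garding_gradient g x) = frechet_derivative (\<lambda>z. ln (g z)) (at x)"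
    unfolding garding_gradient_def
    by (intro bounded_linear_Blinfun_apply has_derivative_bounded_linear)
  moreover assume "garding_gradient g x = y"
  ultimately show "((\<lambda>z. ln (g z)) has_derivative blinfun_apply y) (at x)" by simp
next
  assume "((\<lambda>z. ln (g z)) has_derivative blinfun_apply y) (at x)"
  then show "garding_gradient g x = y"
    unfolding garding_gradient_def by (simp add: blinfun_apply_inverse flip: frechet_derivative_at)
qed

section \<open>Open convex cones, their edges and polars\<close>

locale open_convex_cone =
  fixes C :: "'a::euclidean_space set"
  assumes open_C: "open C" and convex_C: "convex C" and nonempty_C: "C \<noteq> {}"
    and scale_C: "\<And>x c. x \<in> C \<Longrightarrow> c > 0 \<Longrightarrow> c *\<^sub>R x \<in> C"
begin

definition edge :: "'a set" where
  "edge = {v. v \<in> closure C \<and> - v \<in> closure C}"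

lemma zero_in_closure: "0 \<in> closure C"
proof -
  obtain x where x: "x \<in> C" using nonempty_C by blast
  have "(\<lambda>n. inverse (real (Suc n)) *\<^sub>R x) \<longlonglongrightarrow> 0 *\<^sub>R x"
    by (intro tendsto_intros LIMSEQ_inverse_real_of_nat)
  then show ?thesis
    unfolding closure_sequential using scale_C[OF x]
    by (intro exI[of _ "\<lambda>n. inverse (real (Suc n)) *\<^sub>R x"]) simp
qed

lemma closure_scale:
  assumes "x \<in> closure C" "c \<ge> 0"
  shows "c *\<^sub>R x \<in> closure C"
proof (cases "c = 0")
  case False
  have "c *\<^sub>R x \<in> (*\<^sub>R) c ` closure C" using assms(1) by (rule imageI)
  also have "\<dots> = closure ((*\<^sub>R) c ` C)" by (rule closure_scaleR)
  also have "\<dots> \<subseteq> closure C"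
    using scale_C False assms(2) by (intro closure_mono) auto
  finally show ?thesis .
qed (simp add: zero_in_closure)

lemma closure_add:
  assumes "x \<in> closure C" "z \<in> closure C"
  shows "x + z \<in> closure C"
proof -
  have "(1/2) *\<^sub>R x + (1/2) *\<^sub>R z \<in> closure C"
    by (rule convexD[OF convex_closure[OF convex_C] assms]) auto
  from closure_scale[OF this, of 2] show ?thesis by (simp add: scaleR_add_right)
qed

lemma add_closure:
  assumes "x \<in> C" "z \<in> closure C"
  shows "x + z \<in> C"
proof -
  have "z - (1/2) *\<^sub>R (z - x) \<in> interior C"
    by (rule mem_interior_closure_convex_shrink[OF convex_C _ assms(2)])
      (use assms(1) open_C in \<open>auto simp: interior_open\<close>)
  then have "2 *\<^sub>R (z - (1/2) *\<^sub>R (z - x)) \<in> C"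
    using open_C by (intro scale_C) (auto simp: interior_open)
  moreover have "2 *\<^sub>R (z - (1/2) *\<^sub>R (z - x)) = x + z"
    by (simp add: scaleR_diff_right scaleR_2)
  ultimately show ?thesis by simp
qed

lemma subspace_edge: "subspace edge"
proof (rule subspaceI)
  show "0 \<in> edge" by (simp add: edge_def zero_in_closure)
  fix x z assume "x \<in> edge" "z \<in> edge"
  then show "x + z \<in> edge"
    using closure_add[of x z] closure_add[of "-x" "-z"] by (simp add: edge_def)
next
  fix c x assume x: "x \<in> edge"
  show "c *\<^sub>R x \<in> edge"
  proof (cases "c \<ge> 0")
    case True
    then show ?thesis
      using x closure_scale[of x c] closure_scale[of "-x" c] by (simp add: edge_def)
  next
    case False
    then show ?thesis
      using x closure_scale[of x "-c"] closure_scale[of "-x" "-c"] by (simp add: edge_def)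
  qed
qed

lemma polar_nonneg_closure:
  assumes "y \<in> polar C" "x \<in> closure C"
  shows "blinfun_apply y x \<ge> 0"
proof -
  have "closure C \<subseteq> {x. 0 \<le> blinfun_apply y x}"
    using assms(1) by (intro closure_minimal closed_Collect_le continuous_intros) (auto simp: polar_def)
  with assms(2) show ?thesis by blast
qed

text \<open>The nontrivial half of the bipolar theorem: a hyperplane that separates a point from a closed cone
can be moved to the apex.\<close>

lemma polar_separates:
  assumes "z \<notin> closure C"
  shows "\<exists>y\<in>polar C. blinfun_apply y z < 0"
proof -
  obtain a b where ab: "a \<bullet> z < b" "\<And>x. x \<in> closure C \<Longrightarrow> b < a \<bullet> x"
    using separating_hyperplane_closed_point[OF convex_closure[OF convex_C] closed_closure assms] by blast
  have "b < 0" using ab(2)[OF zero_in_closure] by simp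
  have "a \<bullet> x \<ge> 0" if "x \<in> C" for x
  proof (rule ccontr)
    assume "\<not> a \<bullet> x \<ge> 0"
    with \<open>b < 0\<close> have "(b / (a \<bullet> x)) *\<^sub>R x \<in> C"
      using that by (intro scale_C) (auto simp: divide_neg_neg)
    then have "b < a \<bullet> ((b / (a \<bullet> x)) *\<^sub>R x)"
      using ab(2) closure_subset by blast
    with \<open>\<not> a \<bullet> x \<ge> 0\<close> show False by simp
  qed
  then have "blinfun_inner_right a \<in> polar C" by (simp add: polar_def)
  moreover have "blinfun_apply (blinfun_inner_right a) z < 0" using ab(1) \<open>b < 0\<close> by simp
  ultimately show ?thesis by blast
qed

lemma open_polar_subset: "open_polar C \<subseteq> polar C"
  unfolding open_polar_def by (rule interior_of_subset)

text \<open>For a functional \<open>y\<close> in the relative interior of the polar and any \<open>y'\<close> in the polar,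
\<open>y - h y'\<close> is still in the polar for small \<open>h > 0\<close>. Hence \<open>y z \<ge> h (y' z)\<close>, and if \<open>-z\<close> is not
in the closed cone, then some \<open>y'\<close> has \<open>y' z > 0\<close>.\<close>

lemma open_polar_positive:
  assumes y: "y \<in> open_polar C" and z: "z \<in> closure C" and nz: "- z \<notin> closure C"
  shows "blinfun_apply y z > 0"
proof -
  obtain y' where y': "y' \<in> polar C" "blinfun_apply y' (- z) < 0"
    using polar_separates[OF nz] by blast
  obtain T where "openin (top_of_set (span (polar C))) T" "y \<in> T" "T \<subseteq> polar C"
    using y unfolding open_polar_def interior_of_def by blast
  then obtain U where U: "open U" "y \<in> U" "span (polar C) \<inter> U \<subseteq> polar C" "y \<in> span (polar C)"
    by (auto simp: openin_open)
  then obtain d where d: "d > 0" "ball y d \<subseteq> U"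
    by (meson open_contains_ball)
  define h where "h = d / (1 + norm y')"
  have h: "h > 0" using d by (simp add: h_def add_pos_nonneg)
  have "norm (h *\<^sub>R y') < d"
    using d by (simp add: h_def field_simps add_pos_nonneg)
  then have "y - h *\<^sub>R y' \<in> U" using d by (auto simp: dist_norm)
  moreover have "y - h *\<^sub>R y' \<in> span (polar C)"
    by (intro span_diff span_scale U(4) span_base[OF y'(1)])
  ultimately have "blinfun_apply (y - h *\<^sub>R y') z \<ge> 0"
    using U(3) polar_nonneg_closure z by blast
  moreover have "h * blinfun_apply y' z > 0"
    using h y'(2) by (simp add: blinfun.minus_right)
  ultimately show ?thesis
    by (simp add: blinfun.diff_left blinfun.scaleR_left)
qed

lemma polar_zero_edge:
  assumes "y \<in> polar C" "v \<in> edge"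
  shows "blinfun_apply y v = 0"
  using polar_nonneg_closure[OF assms(1), of v] polar_nonneg_closure[OF assms(1), of "- v"] assms(2)
  by (auto simp: edge_def blinfun.minus_right)

text \<open>On the orthogonal complement of the edge the functional \<open>y\<close> is positive on the nonzero points of
the closed cone. By compactness of the unit sphere it then grows at least linearly, so its level
sets there are bounded. Without removing the edge they would be unions of translates of it.\<close>

lemma compact_slice:
  assumes y: "y \<in> open_polar C"
  shows "compact {w \<in> closure C. (\<forall>v\<in>edge. orthogonal w v) \<and> blinfun_apply y w = k}"
proof -
  define W where "W = closure C \<inter> (\<Inter>v\<in>edge. {w. w \<bullet> v = 0})"
  have "closed W"
    unfolding W_def by (intro closed_Int closed_closure closed_INT ballI closed_Collect_eq continuous_intros)
  have pos: "blinfun_apply y w > 0" if "w \<in> W" "w \<noteq> 0" for w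
  proof (rule open_polar_positive[OF y])
    show "w \<in> closure C" using that by (simp add: W_def)
    show "- w \<notin> closure C"
    proof
      assume "- w \<in> closure C"
      with that have "w \<in> edge" by (simp add: edge_def W_def)
      with that show False by (auto simp: W_def)
    qed
  qed
  obtain d where d: "d > 0" "\<And>w. w \<in> W \<Longrightarrow> norm w = 1 \<Longrightarrow> d \<le> blinfun_apply y w"
  proof (cases "W \<inter> sphere 0 1 = {}")
    case True
    then show ?thesis by (intro that[of 1]) (auto simp: disjoint_iff)
  next
    case False
    have "compact (W \<inter> sphere 0 1)"
      using \<open>closed W\<close> by (simp add: closed_Int_compact)
    moreover have "continuous_on (W \<inter> sphere 0 1) (blinfun_apply y)"
      by (intro linear_continuous_on blinfun.bounded_linear_right)
    ultimately obtain w0 where "w0 \<in> W \<inter> sphere 0 1"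
      "\<And>w. w \<in> W \<inter> sphere 0 1 \<Longrightarrow> blinfun_apply y w0 \<le> blinfun_apply y w"
      using continuous_attains_inf[OF _ False] by blast
    moreover from this have "blinfun_apply y w0 > 0" using pos[of w0] by (cases "w0 = 0") auto
    ultimately show ?thesis using that[of "blinfun_apply y w0"] by auto
  qed
  have growth: "d * norm w \<le> blinfun_apply y w" if "w \<in> W" for w
  proof (cases "w = 0")
    case False
    have "inverse (norm w) *\<^sub>R w \<in> W"
      using that by (auto simp: W_def closure_scale)
    from d(2)[OF this] False show ?thesis
      by (simp add: blinfun.scaleR_right field_simps)
  qed simp
  have "{w \<in> closure C. (\<forall>v\<in>edge. orthogonal w v) \<and> blinfun_apply y w = k} =
      W \<inter> {w. blinfun_apply y w = k}"
    by (auto simp: W_def orthogonal_def)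
  moreover have "closed (W \<inter> {w. blinfun_apply y w = k})"
    by (intro closed_Int \<open>closed W\<close> closed_Collect_eq continuous_intros)
  moreover have "bounded (W \<inter> {w. blinfun_apply y w = k})"
    unfolding bounded_iff
  proof (intro exI[of _ "k / d"] ballI)
    fix w assume "w \<in> W \<inter> {w. blinfun_apply y w = k}"
    with growth[of w] d(1) show "norm w \<le> k / d" by (simp add: field_simps)
  qed
  ultimately show ?thesis by (simp add: compact_eq_bounded_closed)
qed

end

section \<open>The minimum of the tilted potential\<close>

lemma garding_open_convex_cone:
  assumes "garding_polynomial N g \<Gamma>"
  shows "open_convex_cone \<Gamma>"
  by unfold_locales
    (use garding_cone_open garding_cone_convex garding_cone_nonempty garding_cone_scale assms in blast)+

lemma garding_open_polar_positive:
  assumes N: "N \<ge> 1" and gard: "garding_polynomial N g \<Gamma>" and y: "y \<in> open_polar \<Gamma>"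
    and x: "x \<in> \<Gamma>"
  shows "blinfun_apply y x > 0"
proof -
  interpret open_convex_cone \<Gamma> by (rule garding_open_convex_cone[OF gard])
  have "- x \<notin> closure \<Gamma>"
  proof
    assume "- x \<in> closure \<Gamma>"
    with x have "0 \<in> \<Gamma>" using add_closure[of x "-x"] by simp
    with N garding_cone_positive[OF gard, of 0] garding_polynomial_homogeneous[OF gard, of 0 0]
    show False by (simp add: zero_power)
  qed
  then show ?thesis
    using open_polar_positive[OF y] x closure_subset by blast
qed

text \<open>The whole line \<open>x + s v\<close> stays in the cone, so the product of the factors \<open>1 + s r\<close> has no real
zero, which forces every \<open>r\<close> to be \<open>0\<close>.\<close>

lemma garding_edge_invariant:
  assumes gard: "garding_polynomial N g \<Gamma>" and x: "x \<in> \<Gamma>" and v: "v \<in> open_convex_cone.edge \<Gamma>"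
  shows "x + v \<in> \<Gamma>" "g (x + v) = g x"
proof -
  interpret open_convex_cone \<Gamma> by (rule garding_open_convex_cone[OF gard])
  have line: "x + s *\<^sub>R v \<in> \<Gamma>" for s
  proof (rule add_closure[OF x])
    show "s *\<^sub>R v \<in> closure \<Gamma>"
      using subspace_scale[OF subspace_edge v, of s] by (simp add: edge_def)
  qed
  from line[of 1] show "x + v \<in> \<Gamma>" by simp
  obtain A where A: "\<And>s. g (x + s *\<^sub>R v) = g x * (\<Prod>r\<in>#A. 1 + s * r)"
    using hyperbolic_direction_line[OF garding_polynomial_homogeneous[OF gard]
        garding_cone_hyperbolic[OF gard x]] by blast
  have "r = 0" if "r \<in># A" for r
  proof (rule ccontr)
    assume "r \<noteq> 0"
    with that have "(\<Prod>q\<in>#A. 1 + (- 1 / r) * q) = 0"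
      by (auto simp: prod_mset_zero_iff image_iff intro!: bexI[of _ r])
    then have "g (x + (- 1 / r) *\<^sub>R v) = 0" unfolding A by simp
    with garding_cone_positive[OF gard line] show False by (metis less_irrefl)
  qed
  then have "(\<Prod>r\<in>#A. 1 + r) = 1" by (induction A) auto
  with A[of 1] show "g (x + v) = g x" by simp
qed

text \<open>Modulo the edge, which changes neither \<open>y\<close> nor \<open>g\<close>, the slice \<open>{y = k}\<close> of the closed cone is
compact. The maximum of \<open>g\<close> on it is positive, so it is attained inside the open cone.\<close>

lemma garding_maximum_on_slice:
  assumes N: "N \<ge> 1" and gard: "garding_polynomial N g \<Gamma>" and y: "y \<in> open_polar \<Gamma>" and k: "k > 0"
  shows "\<exists>x\<in>\<Gamma>. blinfun_apply y x = k \<and> (\<forall>z\<in>\<Gamma>. blinfun_apply y z = k \<longrightarrow> g z \<le> g x)"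
proof -
  interpret open_convex_cone \<Gamma> by (rule garding_open_convex_cone[OF gard])
  define K where "K = {w \<in> closure \<Gamma>. (\<forall>v\<in>edge. orthogonal w v) \<and> blinfun_apply y w = k}"
  have reduce: "\<exists>w\<in>K. g w = g z" if z: "z \<in> \<Gamma>" "blinfun_apply y z = k" for z
  proof -
    obtain u w where uw: "u \<in> span edge" "\<And>v. v \<in> span edge \<Longrightarrow> orthogonal w v" "z = u + w"
      using orthogonal_subspace_decomp_exists[of edge z] by metis
    have "span edge = edge" using subspace_edge by (simp add: span_eq_iff)
    with uw have "- u \<in> edge" by (metis subspace_neg subspace_edge)
    moreover have "w = z + (- u)" using uw(3) by simp
    ultimately have "w \<in> \<Gamma>" "g w = g z" "blinfun_apply y w = k"
      using garding_edge_invariant[OF gard z(1), of "-u"] open_polar_subset y z(2) polar_zero_edge[of y "-u"]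
      by (auto simp: blinfun.add_right simp del: add_uminus_conv_diff)
    with uw(2) show ?thesis
      using closure_subset \<open>span edge = edge\<close> by (intro bexI[of _ w]) (auto simp: K_def)
  qed
  obtain e where e: "e \<in> \<Gamma>" using nonempty_C by blast
  have ye: "blinfun_apply y e > 0"
    by (rule garding_open_polar_positive[OF N gard y e])
  define e' where "e' = (k / blinfun_apply y e) *\<^sub>R e"
  have e': "e' \<in> \<Gamma>" "blinfun_apply y e' = k"
    using ye k e by (auto simp: e'_def blinfun.scaleR_right intro: scale_C)
  have "K \<noteq> {}" using reduce[OF e'] by blast
  moreover have "compact K" unfolding K_def by (rule compact_slice[OF y])
  ultimately obtain x where x: "x \<in> K" "\<And>w. w \<in> K \<Longrightarrow> g w \<le> g x"
    using continuous_attains_sup[OF _ _ garding_polynomial_continuous[OF gard]] by metis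
  have max: "g z \<le> g x" if "z \<in> \<Gamma>" "blinfun_apply y z = k" for z
    using reduce[OF that] x(2) by metis
  have "g x > 0"
    using max[OF e'] garding_cone_positive[OF gard e'(1)] by simp
  with x(1) have "x \<in> \<Gamma>"
    using garding_cone_closure_positive[OF gard] by (simp add: K_def)
  with x(1) max show ?thesis by (auto simp: K_def)
qed

text \<open>Writing a point of the cone as \<open>s\<close> times a point of the slice \<open>{y = N}\<close> separates the
minimization of \<open>y - ln g\<close> into two: the term \<open>- ln g\<close> is smallest at the maximum of \<open>g\<close> on the
slice, and \<open>N s - N ln s\<close> is smallest at \<open>s = 1\<close>. The level \<open>N\<close> is chosen to have this optimum at
\<open>s = 1\<close>.\<close>

lemma garding_minimizer:
  assumes N: "N \<ge> 1" and gard: "garding_polynomial N g \<Gamma>" and y: "y \<in> open_polar \<Gamma>"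
  shows "\<exists>x\<in>\<Gamma>. blinfun_apply y x = real N \<and>
    (\<forall>z\<in>\<Gamma>. real N - ln (g x) \<le> blinfun_apply y z - ln (g z))"
proof -
  interpret open_convex_cone \<Gamma> by (rule garding_open_convex_cone[OF gard])
  obtain x where x: "x \<in> \<Gamma>" "blinfun_apply y x = real N"
    and max: "\<And>z. z \<in> \<Gamma> \<Longrightarrow> blinfun_apply y z = real N \<Longrightarrow> g z \<le> g x"
    using garding_maximum_on_slice[OF N gard y, of "real N"] N by auto
  have "real N - ln (g x) \<le> blinfun_apply y z - ln (g z)" if z: "z \<in> \<Gamma>" for z
  proof -
    have "blinfun_apply y z > 0"
      by (rule garding_open_polar_positive[OF N gard y z])
    define s where "s = blinfun_apply y z / real N"
    have s: "s > 0" "blinfun_apply y z = s * real N"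
      using \<open>blinfun_apply y z > 0\<close> N by (auto simp: s_def)
    have pos: "g z > 0" "g x > 0" using garding_cone_positive[OF gard] z x by auto
    have "g (inverse s *\<^sub>R z) \<le> g x"
      using s z by (intro max scale_C) (auto simp: blinfun.scaleR_right)
    then have "g z \<le> s ^ N * g x"
      using s(1) by (simp add: garding_polynomial_homogeneous[OF gard] field_simps)
    then have "ln (g z) \<le> ln (s ^ N * g x)"
      using pos by simp
    also have "\<dots> = real N * ln s + ln (g x)"
      using pos s(1) by (simp add: ln_mult_pos ln_realpow)
    also have "real N * ln s \<le> real N * (s - 1)"
      using ln_le_minus_one[OF s(1)] by (intro mult_left_mono) auto
    finally show ?thesis using s(2) by (simp add: algebra_simps)
  qed
  with x show ?thesis by blast
qed

lemma garding_gradient_at_minimizer: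
  assumes gard: "garding_polynomial N g \<Gamma>" and x: "x \<in> \<Gamma>"
    and min: "\<And>z. z \<in> \<Gamma> \<Longrightarrow> blinfun_apply y x - ln (g x) \<le> blinfun_apply y z - ln (g z)"
  shows "garding_gradient g x = y"
proof -
  have "((\<lambda>z. ln (g z)) has_derivative blinfun_apply (garding_gradient g x)) (at x)"
    using garding_gradient_eq_iff[OF gard x] by blast
  then have "((\<lambda>z. blinfun_apply y z - ln (g z)) has_derivative
      (\<lambda>h. blinfun_apply y h - blinfun_apply (garding_gradient g x) h)) (at x)"
    by (intro has_derivative_diff bounded_linear_imp_has_derivative blinfun.bounded_linear_right)
  moreover have "\<forall>\<^sub>F z in at x. blinfun_apply y x - ln (g x) \<le> blinfun_apply y z - ln (g z)"
    using min garding_cone_open[OF gard] x by (auto simp: eventually_at_topological)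
  ultimately have "(\<lambda>h. blinfun_apply y h - blinfun_apply (garding_gradient g x) h) = (\<lambda>h. 0)"
    by (rule has_derivative_local_min)
  then show ?thesis
    by (intro blinfun_eqI) (metis eq_iff_diff_eq_0)
qed

theorem theorem10p8:
  fixes g :: "'a::euclidean_space \<Rightarrow> real" and \<Gamma> :: "'a set" and N :: nat
  assumes "N \<ge> 1"
    and "garding_polynomial N g \<Gamma>"
  shows "\<forall>y\<in>open_polar \<Gamma>.
    ereal (dual_potential g \<Gamma> y) =
      (INF x\<in>\<Gamma>. ereal (blinfun_apply y x - potential g x - real N))"
proof
  fix y assume y: "y \<in> open_polar \<Gamma>"
  note gard = assms(2)
  obtain x where x: "x \<in> \<Gamma>" "blinfun_apply y x = real N"
    and min: "\<And>z. z \<in> \<Gamma> \<Longrightarrow> real N - ln (g x) \<le> blinfun_apply y z - ln (g z)"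
    using garding_minimizer[OF assms y] by blast
  have grad: "garding_gradient g x = y"
    using min x(2) by (intro garding_gradient_at_minimizer[OF gard x(1)]) simp
  \<comment> \<open>Any critical point of the convex function \<open>y - ln g\<close> is a minimizer, and by Euler's identity
    \<open>y\<close> takes the same value \<open>N\<close> at all of them; so \<open>g\<close> does too.\<close>
  have unique: "g z = g x" if z: "z \<in> \<Gamma>" "garding_gradient g z = y" for z
  proof -
    have deriv: "((\<lambda>z. ln (g z)) has_derivative blinfun_apply y) (at z)"
      using garding_gradient_eq_iff[OF gard z(1)] z(2) by blast
    have "blinfun_apply y z = real N"
      by (rule garding_ln_euler[OF gard z(1) deriv])
    with concave_on_imp_below_tangent[OF garding_concave_ln[OF gard] z(1) x(1) deriv] x(2) min[OF z(1)]
    have "ln (g z) = ln (g x)" by (simp add: blinfun.diff_right)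
    with garding_cone_positive[OF gard] z(1) x(1) show ?thesis by simp
  qed
  have "dual_garding_function g \<Gamma> y = 1 / g x"
    unfolding dual_garding_function_def
  proof (rule the_equality)
    show "\<exists>z\<in>\<Gamma>. garding_gradient g z = y \<and> 1 / g x = 1 / g z"
      using x(1) grad by blast
    show "c = 1 / g x" if "\<exists>z\<in>\<Gamma>. garding_gradient g z = y \<and> c = 1 / g z" for c
      using that unique by metis
  qed
  then have dual: "dual_potential g \<Gamma> y = - ln (g x)"
    using garding_cone_positive[OF gard x(1)] by (simp add: dual_potential_def ln_div)
  show "ereal (dual_potential g \<Gamma> y) =
      (INF x\<in>\<Gamma>. ereal (blinfun_apply y x - potential g x - real N))"
  proof (rule antisym)
    show "ereal (dual_potential g \<Gamma> y) \<le> (INF x\<in>\<Gamma>. ereal (blinfun_apply y x - potential g x - real N))"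
      unfolding dual by (intro INF_greatest) (use min in \<open>force simp: potential_def\<close>)
    show "(INF x\<in>\<Gamma>. ereal (blinfun_apply y x - potential g x - real N)) \<le> ereal (dual_potential g \<Gamma> y)"
      unfolding dual by (rule INF_lower2[OF x(1)]) (simp add: potential_def x(2))
  qed
qed

end
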